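(* Let $\alpha=\alpha_1\alpha_2\ldots$ be an infinite binary word containing infinitely many $1$s. Then the clique-width of graphs in the class $\mathcal{G}_\alpha$ is unbounded, i.e. there is no constant $c$ such that every graph in $\mathcal{G}_\alpha$ has clique-width at most $c$.
   Context: Graphs are undirected, without loops or multiple edges. The clique-width of a finite graph $G$ is the minimum number of labels needed to construct $G$ by an expression using the following operations: creation of a new vertex with label $i$; disjoint union of two labelled graphs; $\eta_{i,j}$ ($i\neq j$), adding all edges between vertices labelled $i$ and vertices labelled $j$; $\rho_{i\to j}$, renaming label $i$ to label $j$. Let $\mathbb{N}=\{1,2,\ldots\}$. The graph $\mathcal{P}$ has vertex set $\{v_{i,j}: i,j\in\mathbb{N}\}$ and edge set $\{\{v_{i,j},v_{i,j+1}\}: i,j\in\mathbb{N}\}$. Its $j$th column is $V_j=\{v_{i,j}: i\in\mathbb{N}\}$. For an infinite binary word $\alpha$ (each $\alpha_j\in\{0,1\}$), the graph $\mathcal{P}^\alpha$ is obtained from $\mathcal{P}$ by complementing the edges between $V_j$ and $V_{j+1}$ for exactly those $j$ with $\alpha_j=1$; that is, the only edges are between consecutive columns, and $v_{i,j}$ is adjacent to $v_{k,j+1}$ iff ($\alpha_j=0$ and $i=k$) or ($\alpha_j=1$ and $i\neq k$). The class $\mathcal{G}_\alpha$ consists of all finite induced subgraphs of $\mathcal{P}^\alpha$ (up to isomorphism). *)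

theory Defs
  imports Main
begin

section \<open>Simple undirected graphs\<close>

record 'v ugraph =
  verts :: "'v set"
  edges :: "'v set set"

definition simple_graph :: "'v ugraph \<Rightarrow> bool" where
  "simple_graph G \<longleftrightarrow>
     (\<forall>e \<in> edges G. \<exists>u \<in> verts G. \<exists>v \<in> verts G. u \<noteq> v \<and> e = {u, v})"

definition induced_subgraph :: "'v ugraph \<Rightarrow> 'v set \<Rightarrow> 'v ugraph" where
  "induced_subgraph G S = \<lparr>verts = S, edges = {e \<in> edges G. e \<subseteq> S}\<rparr>"

definition graph_iso :: "'v ugraph \<Rightarrow> 'w ugraph \<Rightarrow> bool" where
  "graph_iso G H \<longleftrightarrow>
     (\<exists>f. bij_betw f (verts G) (verts H) \<and> edges H = (\<lambda>e. f ` e) ` edges G)"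


section \<open>Clique-width\<close>

text \<open>
  A created vertex carries its name, so an expression denotes a concrete labelled graph on the
  vertex type, and a union is admissible only if its two operands have no vertex in common.
\<close>

datatype 'v cw_expr =
    Create nat 'v
  | Disj_Union "'v cw_expr" "'v cw_expr"
  | Join nat nat "'v cw_expr"
  | Relabel nat nat "'v cw_expr"

primrec cw_verts :: "'v cw_expr \<Rightarrow> 'v set" where
  "cw_verts (Create i v) = {v}"
| "cw_verts (Disj_Union a b) = cw_verts a \<union> cw_verts b"
| "cw_verts (Join i j a) = cw_verts a"
| "cw_verts (Relabel i j a) = cw_verts a"

text \<open>The value of \<open>cw_label a\<close> is meaningful only on \<open>cw_verts a\<close>.\<close>

primrec cw_label :: "'v cw_expr \<Rightarrow> 'v \<Rightarrow> nat" where
  "cw_label (Create i v) = (\<lambda>x. i)"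
| "cw_label (Disj_Union a b) =
     (\<lambda>x. if x \<in> cw_verts a then cw_label a x else cw_label b x)"
| "cw_label (Join i j a) = cw_label a"
| "cw_label (Relabel i j a) = (\<lambda>x. if cw_label a x = i then j else cw_label a x)"

primrec cw_edges :: "'v cw_expr \<Rightarrow> 'v set set" where
  "cw_edges (Create i v) = {}"
| "cw_edges (Disj_Union a b) = cw_edges a \<union> cw_edges b"
| "cw_edges (Join i j a) = cw_edges a \<union>
     {{u, v} |u v. u \<in> cw_verts a \<and> v \<in> cw_verts a \<and> cw_label a u = i \<and> cw_label a v = j}"
| "cw_edges (Relabel i j a) = cw_edges a"

definition cw_graph :: "'v cw_expr \<Rightarrow> 'v ugraph" where
  "cw_graph a = \<lparr>verts = cw_verts a, edges = cw_edges a\<rparr>"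

primrec cw_wf :: "'v cw_expr \<Rightarrow> bool" where
  "cw_wf (Create i v) \<longleftrightarrow> True"
| "cw_wf (Disj_Union a b) \<longleftrightarrow> cw_wf a \<and> cw_wf b \<and> cw_verts a \<inter> cw_verts b = {}"
| "cw_wf (Join i j a) \<longleftrightarrow> i \<noteq> j \<and> cw_wf a"
| "cw_wf (Relabel i j a) \<longleftrightarrow> cw_wf a"

primrec cw_labels :: "'v cw_expr \<Rightarrow> nat set" where
  "cw_labels (Create i v) = {i}"
| "cw_labels (Disj_Union a b) = cw_labels a \<union> cw_labels b"
| "cw_labels (Join i j a) = {i, j} \<union> cw_labels a"
| "cw_labels (Relabel i j a) = {i, j} \<union> cw_labels a"

text \<open>
  No expression denotes the graph without vertices, so its clique-width is set to 0 by convention.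
  Every other finite simple graph is denoted by some expression (one label per vertex suffices);
  the value on infinite graphs is irrelevant.
\<close>

definition clique_width :: "'v ugraph \<Rightarrow> nat" where
  "clique_width G =
     (if verts G = {} then 0
      else (LEAST k. \<exists>a. cw_wf a \<and> cw_graph a = G \<and> card (cw_labels a) = k))"


section \<open>The graph of a binary word and its class\<close>

text \<open>
  The pair \<open>(i, j)\<close> stands for $v_{i,j}$ (row \<open>i\<close>, column \<open>j\<close>); indices start at 1, and the value
  \<open>\<alpha> 0\<close> is never used.
\<close>

definition P_graph :: "(nat \<Rightarrow> nat) \<Rightarrow> (nat \<times> nat) ugraph" where
  "P_graph \<alpha> =
     \<lparr>verts = {(i, j). 1 \<le> i \<and> 1 \<le> j},
      edges = {{(i, j), (k, j + 1)} |i j k. 1 \<le> i \<and> 1 \<le> j \<and> 1 \<le> k \<and>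
                 (\<alpha> j = 0 \<and> i = k \<or> \<alpha> j = 1 \<and> i \<noteq> k)}\<rparr>"

text \<open>
  Closed under isomorphism. The vertex type is a parameter; over any infinite vertex type, every
  isomorphism type of finite induced subgraphs is represented.
\<close>

definition G_class :: "(nat \<Rightarrow> nat) \<Rightarrow> 'v ugraph set" where
  "G_class \<alpha> =
     {H. \<exists>S. finite S \<and> S \<subseteq> verts (P_graph \<alpha>) \<and>
             graph_iso (induced_subgraph (P_graph \<alpha>) S) H}"


section \<open>Basic facts\<close>

lemma simple_graph_P_graph: "simple_graph (P_graph \<alpha>)"
  unfolding simple_graph_def
proof
  fix e assume "e \<in> edges (P_graph \<alpha>)"
  then obtain i j k where "1 \<le> i" "1 \<le> j" "1 \<le> k" and e: "e = {(i, j), (k, j + 1)}"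
    by (auto simp: P_graph_def)
  then have "(i, j) \<in> verts (P_graph \<alpha>)" "(k, j + 1) \<in> verts (P_graph \<alpha>)"
    by (auto simp: P_graph_def)
  moreover have "(i, j) \<noteq> (k, j + 1)"
    by simp
  ultimately show "\<exists>u \<in> verts (P_graph \<alpha>). \<exists>v \<in> verts (P_graph \<alpha>). u \<noteq> v \<and> e = {u, v}"
    using e by blast
qed

lemma P_graph_adjacent_columns:
  assumes "1 \<le> i" "1 \<le> j" "1 \<le> k"
  shows "{(i, j), (k, j + 1)} \<in> edges (P_graph \<alpha>) \<longleftrightarrow>
           \<alpha> j = 0 \<and> i = k \<or> \<alpha> j = 1 \<and> i \<noteq> k"
  using assms by (auto simp: P_graph_def doubleton_eq_iff)

lemma simple_graph_cw_graph: "cw_wf a \<Longrightarrow> simple_graph (cw_graph a)"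
proof (induction a)
  case (Create i v)
  then show ?case by (simp add: simple_graph_def cw_graph_def)
next
  case (Disj_Union a b)
  then have a: "simple_graph (cw_graph a)" and b: "simple_graph (cw_graph b)"
    by simp_all
  have "\<exists>u \<in> cw_verts a \<union> cw_verts b. \<exists>v \<in> cw_verts a \<union> cw_verts b. u \<noteq> v \<and> e = {u, v}"
    if "e \<in> cw_edges a \<union> cw_edges b" for e
    using that
  proof
    assume "e \<in> cw_edges a"
    with a obtain u v where "u \<in> cw_verts a" "v \<in> cw_verts a" "u \<noteq> v" "e = {u, v}"
      unfolding simple_graph_def cw_graph_def by (metis ugraph.select_convs)
    then show ?thesis by (intro bexI[of _ u] bexI[of _ v]) simp_all
  next
    assume "e \<in> cw_edges b"
    with b obtain u v where "u \<in> cw_verts b" "v \<in> cw_verts b" "u \<noteq> v" "e = {u, v}"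
      unfolding simple_graph_def cw_graph_def by (metis ugraph.select_convs)
    then show ?thesis by (intro bexI[of _ u] bexI[of _ v]) simp_all
  qed
  then show ?case by (simp add: simple_graph_def cw_graph_def)
next
  case (Join i j a)
  have "\<exists>u \<in> cw_verts a. \<exists>v \<in> cw_verts a. u \<noteq> v \<and> e = {u, v}"
    if "e \<in> cw_edges (Join i j a)" for e
  proof (cases "e \<in> cw_edges a")
    case True
    with Join show ?thesis by (simp add: simple_graph_def cw_graph_def)
  next
    case False
    with that obtain u v where "u \<in> cw_verts a" "v \<in> cw_verts a" "e = {u, v}"
        "cw_label a u = i" "cw_label a v = j"
      by auto
    with Join.prems show ?thesis by (metis cw_wf.simps(3))
  qed
  then show ?case by (simp add: simple_graph_def cw_graph_def)
next
  case (Relabel i j a)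
  then show ?case by (simp add: simple_graph_def cw_graph_def)
qed

end

(* Some node of a clique-width expression of the n x m grid part of the graph carries between one and
   two thirds of the vertices; call them red and the others blue.  Red vertices of equal label have the
   same blue neighbours, so every configuration that forces many distinct blue neighbourhoods is
   bounded by the number of labels.  Two such configurations occur: many rows with different colours in
   two fixed consecutive columns, and many pairs of consecutive columns joined by an edge between red
   and blue (pairs at distance at least 3 form an induced matching).  If many rows contain both
   colours, one of the two appears.  Otherwise some row is entirely red and another entirely blue, and
   then every 1 of the word yields an edge between red and blue. *)

theory Submission
  imports Defs
begin

section \<open>Expressions\<close>

lemma finite_cw_labels: "finite (cw_labels a)"
  by (induction a) auto

lemma cw_label_in_labels: "x \<in> cw_verts a \<Longrightarrow> cw_label a x \<in> cw_labels a"
  by (induction a) auto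

lemma cw_edges_subset_verts: "e \<in> cw_edges a \<Longrightarrow> e \<subseteq> cw_verts a"
  by (induction a arbitrary: e) auto

lemma ex_cw_expr_edgeless:
  assumes "finite V" "V \<noteq> {}"
  shows "\<exists>a. cw_wf a \<and> cw_verts a = V \<and> cw_edges a = {} \<and> inj_on (cw_label a) V"
  using assms
proof (induction rule: finite_ne_induct)
  case (singleton v)
  then show ?case by (intro exI[of _ "Create 0 v"]) simp
next
  case (insert v V)
  then obtain a where a: "cw_wf a" "cw_verts a = V" "cw_edges a = {}" "inj_on (cw_label a) V"
    by auto
  obtain l where l: "l \<notin> cw_labels a"
    using ex_new_if_finite[OF infinite_UNIV_nat finite_cw_labels] by blast
  have new: "l \<noteq> cw_label a x" if "x \<in> V" for x
    using cw_label_in_labels[of x a] that l a(2) by auto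
  show ?case
  proof (intro exI conjI)
    show "inj_on (cw_label (Disj_Union (Create l v) a)) (insert v V)"
      using a(4) insert.hyps new new[symmetric] by (auto simp: inj_on_def)
  qed (use a insert.hyps in auto)
qed

text \<open>Start from an edgeless expression with pairwise distinct labels. A \<open>Join\<close>
  of the labels of \<open>u\<close> and \<open>v\<close> then adds the single edge
  \<open>{u, v}\<close> and changes no label, so edges can be inserted one at a time. This makes the
  minimum in \<open>clique_width\<close> attained.\<close>

lemma ex_cw_expr:
  assumes fin: "finite (verts G)" and ne: "verts G \<noteq> {}" and simple: "simple_graph G"
  shows "\<exists>a. cw_wf a \<and> cw_graph a = G"
proof -
  have "edges G \<subseteq> Pow (verts G)"
    using simple by (auto simp: simple_graph_def)
  then have "finite (edges G)"
    using fin by (meson finite_Pow_iff finite_subset)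
  moreover have "\<exists>a. cw_wf a \<and> cw_verts a = verts G \<and> cw_edges a = E \<and> inj_on (cw_label a) (verts G)"
    if "finite E" "E \<subseteq> edges G" for E
    using that
  proof (induction E rule: finite_induct)
    case empty
    then show ?case using ex_cw_expr_edgeless[OF fin ne] by simp
  next
    case (insert e E)
    then obtain a where a: "cw_wf a" "cw_verts a = verts G" "cw_edges a = E"
        "inj_on (cw_label a) (verts G)"
      by auto
    have "e \<in> edges G"
      using insert.prems by simp
    then obtain u v where uv: "u \<in> verts G" "v \<in> verts G" "u \<noteq> v" "e = {u, v}"
      using simple unfolding simple_graph_def by metis
    have "{{x, y} |x y. x \<in> verts G \<and> y \<in> verts G \<and> cw_label a x = cw_label a u
            \<and> cw_label a y = cw_label a v} =
          {{x, y} |x y. x = u \<and> y = v}"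
      using uv(1,2) inj_on_eq_iff[OF a(4)] by metis
    then have "cw_edges (Join (cw_label a u) (cw_label a v) a) = insert e E"
      using a uv(4) by simp
    moreover have "cw_label a u \<noteq> cw_label a v"
      using uv inj_onD[OF a(4)] by blast
    ultimately show ?case
      using a by (intro exI[of _ "Join (cw_label a u) (cw_label a v) a"]) simp
  qed
  ultimately obtain a where "cw_wf a" "cw_verts a = verts G" "cw_edges a = edges G"
    by blast
  then show ?thesis
    by (intro exI[of _ a]) (simp add: cw_graph_def)
qed

lemma clique_width_witness:
  assumes "finite (verts G)" "verts G \<noteq> {}" "simple_graph G"
  obtains a where "cw_wf a" "cw_graph a = G" "card (cw_labels a) = clique_width G"
proof -
  have "\<exists>k a. cw_wf a \<and> cw_graph a = G \<and> card (cw_labels a) = k"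
    using ex_cw_expr[OF assms] by blast
  from LeastI_ex[OF this] show thesis
    using that assms(2) by (auto simp: clique_width_def)
qed

section \<open>Twin labellings and balanced subexpressions\<close>

text \<open>The labelling \<open>l\<close> is meant to be that of a subexpression with vertex set \<open>A\<close>; the clause on
  \<open>cw_label a\<close> serves the induction over the enclosing operations.\<close>

definition twin_labelling :: "'v cw_expr \<Rightarrow> 'v set \<Rightarrow> ('v \<Rightarrow> nat) \<Rightarrow> bool" where
  "twin_labelling a A l \<longleftrightarrow> A \<subseteq> cw_verts a \<and> l ` A \<subseteq> cw_labels a \<and>
     (\<forall>x\<in>A. \<forall>y\<in>A. l x = l y \<longrightarrow> cw_label a x = cw_label a y \<and>
       (\<forall>z. z \<notin> A \<longrightarrow> {x, z} \<in> cw_edges a \<longleftrightarrow> {y, z} \<in> cw_edges a))"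

lemma twin_labelling_self: "twin_labelling a (cw_verts a) (cw_label a)"
proof -
  have "{x, z} \<notin> cw_edges a" if "z \<notin> cw_verts a" for x z
    using cw_edges_subset_verts[of "{x, z}" a] that by blast
  then show ?thesis
    using cw_label_in_labels[of _ a] by (auto simp: twin_labelling_def)
qed

text \<open>One step outwards from \<open>a\<close> to an enclosing operation \<open>b\<close>:
  \<open>A\<close> and \<open>l\<close> stay fixed, and it suffices that \<open>b\<close> does not
  separate vertices of \<open>A\<close> whose current labels in \<open>a\<close> agree.\<close>

lemma twin_labelling_transfer:
  assumes tw: "twin_labelling a A l"
    and sub: "cw_verts a \<subseteq> cw_verts b" "cw_labels a \<subseteq> cw_labels b"
    and label: "\<And>x y. \<lbrakk>x \<in> A; y \<in> A; cw_label a x = cw_label a y\<rbrakk> \<Longrightarrow> cw_label b x = cw_label b y"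
    and edge: "\<And>x y z. \<lbrakk>x \<in> A; y \<in> A; cw_label a x = cw_label a y; z \<notin> A;
        {x, z} \<in> cw_edges a \<longleftrightarrow> {y, z} \<in> cw_edges a\<rbrakk>
      \<Longrightarrow> {x, z} \<in> cw_edges b \<longleftrightarrow> {y, z} \<in> cw_edges b"
  shows "twin_labelling b A l"
  unfolding twin_labelling_def
proof (intro conjI ballI impI allI)
  show "A \<subseteq> cw_verts b" "l ` A \<subseteq> cw_labels b"
    using tw sub unfolding twin_labelling_def by (meson order_trans)+
next
  fix x y assume xy: "x \<in> A" "y \<in> A" "l x = l y"
  then have same: "cw_label a x = cw_label a y"
    using tw unfolding twin_labelling_def by metis
  then show "cw_label b x = cw_label b y"
    using label xy by metis
  fix z assume "z \<notin> A"
  moreover from this have "{x, z} \<in> cw_edges a \<longleftrightarrow> {y, z} \<in> cw_edges a"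
    using tw xy unfolding twin_labelling_def by metis
  ultimately show "{x, z} \<in> cw_edges b \<longleftrightarrow> {y, z} \<in> cw_edges b"
    by (intro edge xy same)
qed

lemma twin_labelling_Disj_Union:
  assumes disj: "cw_verts a \<inter> cw_verts b = {}"
  shows "twin_labelling a A l \<Longrightarrow> twin_labelling (Disj_Union a b) A l"
    and "twin_labelling b A l \<Longrightarrow> twin_labelling (Disj_Union a b) A l"
proof -
  assume tw: "twin_labelling a A l"
  have "x \<in> cw_verts a" "{x, z} \<notin> cw_edges b" if "x \<in> A" for x z
    using that tw disj cw_edges_subset_verts[of "{x, z}" b] by (auto simp: twin_labelling_def)
  then show "twin_labelling (Disj_Union a b) A l"
    by (intro twin_labelling_transfer[OF tw]) simp_all
next
  assume tw: "twin_labelling b A l"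
  have "x \<notin> cw_verts a" "{x, z} \<notin> cw_edges a" if "x \<in> A" for x z
    using that tw disj cw_edges_subset_verts[of "{x, z}" a] by (auto simp: twin_labelling_def)
  then show "twin_labelling (Disj_Union a b) A l"
    by (intro twin_labelling_transfer[OF tw]) simp_all
qed

text \<open>A join looks only at current labels, so it treats vertices with equal
  \<open>cw_label a\<close> alike.\<close>

lemma twin_labelling_Join:
  assumes "twin_labelling a A l"
  shows "twin_labelling (Join i j a) A l"
proof -
  have mem: "{x, z} \<in> cw_edges (Join i j a) \<longleftrightarrow> {x, z} \<in> cw_edges a \<or>
      x \<in> cw_verts a \<and> z \<in> cw_verts a \<and>
      (cw_label a x = i \<and> cw_label a z = j \<or> cw_label a z = i \<and> cw_label a x = j)" for x z
    by (auto simp: doubleton_eq_iff)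
  have "x \<in> cw_verts a" if "x \<in> A" for x
    using that assms by (auto simp: twin_labelling_def)
  then show ?thesis
    by (intro twin_labelling_transfer[OF assms], unfold mem) auto
qed

lemma twin_labelling_Relabel:
  "twin_labelling a A l \<Longrightarrow> twin_labelling (Relabel i j a) A l"
  by (rule twin_labelling_transfer) auto

text \<open>Descend into an operand with more than \<open>t\<close> vertices until at most
  \<open>2 * t\<close> remain. A union of more than \<open>2 * t\<close> vertices always has such an
  operand, and the other operations keep the vertex set. \<open>t\<close> will be a third of the
  vertices.\<close>

lemma ex_balanced_twin_labelling:
  assumes "cw_wf a" "1 \<le> t" "t < card (cw_verts a)"
  shows "\<exists>A l. twin_labelling a A l \<and> t < card A \<and> card A \<le> 2 * t"
  using assms
proof (induction a)
  case (Create i v)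
  then show ?case by simp
next
  case (Disj_Union a b)
  show ?case
  proof (cases "card (cw_verts a \<union> cw_verts b) \<le> 2 * t")
    case True
    then show ?thesis
      using Disj_Union.prems(3) twin_labelling_self[of "Disj_Union a b"] by auto
  next
    case False
    then consider "t < card (cw_verts a)" | "t < card (cw_verts b)"
      using card_Un_le[of "cw_verts a" "cw_verts b"] by linarith
    then show ?thesis
      using Disj_Union twin_labelling_Disj_Union[of a b] by cases (simp, blast)+
  qed
next
  case (Join i j a)
  then show ?case using twin_labelling_Join by fastforce
next
  case (Relabel i j a)
  then show ?case using twin_labelling_Relabel by fastforce
qed

section \<open>Cuts of the grid\<close>

lemma P_graph_edge_columns:
  "{(i, j), (k, l)} \<in> edges (P_graph \<alpha>) \<Longrightarrow> l = Suc j \<or> j = Suc l"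
  by (auto simp: P_graph_def doubleton_eq_iff)

text \<open>The expression is forgotten and only its trace on the grid is kept: \<open>A\<close> is
  red, the rest of the grid is blue, and all bounds below are in terms of the number of labels in
  \<open>L\<close>.\<close>

locale labelled_cut =
  fixes \<alpha> :: "nat \<Rightarrow> nat" and n m :: nat and A :: "(nat \<times> nat) set"
    and lab :: "nat \<times> nat \<Rightarrow> nat" and L :: "nat set"
  assumes binary: "\<And>j. 1 \<le> j \<Longrightarrow> \<alpha> j \<in> {0, 1}"
    and A_subset: "A \<subseteq> {1..n} \<times> {1..m}"
    and fin_L: "finite L"
    and lab_L: "lab ` A \<subseteq> L"
    and twins: "\<lbrakk>x \<in> A; y \<in> A; lab x = lab y; z \<in> {1..n} \<times> {1..m} - A\<rbrakk>
      \<Longrightarrow> {x, z} \<in> edges (P_graph \<alpha>) \<longleftrightarrow> {y, z} \<in> edges (P_graph \<alpha>)"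
begin

abbreviation grid :: "(nat \<times> nat) set" where
  "grid \<equiv> {1..n} \<times> {1..m}"

definition crossing_rows :: "nat \<Rightarrow> nat set" where
  "crossing_rows j = {i \<in> {1..n}. (i, j) \<in> A \<longleftrightarrow> (i, Suc j) \<notin> A}"

text \<open>The index \<open>j\<close> stands for the pair of columns \<open>j\<close> and
  \<open>Suc j\<close>. Either end of the edge may be the red one, hence the symmetric conditions on
  \<open>snd u\<close> and \<open>snd w\<close>.\<close>

definition cut_columns :: "nat set" where
  "cut_columns = {j. 1 \<le> j \<and> j < m \<and> (\<exists>u\<in>A. \<exists>w\<in>grid - A.
     snd u \<in> {j, Suc j} \<and> snd w \<in> {j, Suc j} \<and> {u, w} \<in> edges (P_graph \<alpha>))}"

definition mixed_rows :: "nat set" where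
  "mixed_rows = {i \<in> {1..n}. \<exists>j\<in>{1..m}. \<exists>l\<in>{1..m}. (i, j) \<in> A \<and> (i, l) \<notin> A}"

lemma edge_iff:
  assumes "i \<in> {1..n}" "k \<in> {1..n}" "1 \<le> j"
  shows "{(i, j), (k, Suc j)} \<in> edges (P_graph \<alpha>) \<longleftrightarrow> (\<alpha> j = 0 \<longleftrightarrow> i = k)"
  using P_graph_adjacent_columns[of i j k \<alpha>] binary[of j] assms by auto

lemma edge_iff':
  assumes "i \<in> {1..n}" "k \<in> {1..n}" "1 \<le> j"
  shows "{(k, Suc j), (i, j)} \<in> edges (P_graph \<alpha>) \<longleftrightarrow> (\<alpha> j = 0 \<longleftrightarrow> i = k)"
  using edge_iff[OF assms] by (simp add: insert_commute)

text \<open>Rows with the same orientation of the colours need distinct labels, since the blue vertex of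
  one row tells its red vertex apart from that of any other row.\<close>

lemma card_crossing_rows:
  assumes j: "1 \<le> j" "j < m"
  shows "card (crossing_rows j) \<le> 2 * card L"
proof -
  \<comment> \<open>The Boolean records which of the two columns holds the red vertex; it accounts
    for the factor 2.\<close>
  let ?f = "\<lambda>i. ((i, j) \<in> A, if (i, j) \<in> A then lab (i, j) else lab (i, Suc j))"
  have "i = k" if ik: "i \<in> crossing_rows j" "k \<in> crossing_rows j" and eq: "?f i = ?f k" for i k
  proof (cases "(i, j) \<in> A")
    case True
    then have "(k, j) \<in> A" "lab (i, j) = lab (k, j)" "(i, Suc j) \<in> grid - A"
      using eq ik j by (auto simp: crossing_rows_def split: if_splits)
    \<comment> \<open>The blue vertex \<open>(i, Suc j)\<close> sees \<open>(i, j)\<close> iff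
      \<open>\<alpha> j = 0\<close>, but sees \<open>(k, j)\<close> with \<open>k \<noteq> i\<close>
      iff \<open>\<alpha> j \<noteq> 0\<close>.\<close>
    from twins[OF True this] show ?thesis
      using ik j edge_iff[of i i j] edge_iff[of k i j] by (auto simp: crossing_rows_def)
  next
    case False
    then have "(i, Suc j) \<in> A" "(k, Suc j) \<in> A" "lab (i, Suc j) = lab (k, Suc j)" "(i, j) \<in> grid - A"
      using eq ik j by (auto simp: crossing_rows_def split: if_splits)
    from twins[OF this] show ?thesis
      using ik j edge_iff'[of i i j] edge_iff'[of i k j] by (auto simp: crossing_rows_def)
  qed
  then have "inj_on ?f (crossing_rows j)"
    by (intro inj_onI)
  moreover have "?f ` crossing_rows j \<subseteq> UNIV \<times> L"
    using lab_L by (auto simp: crossing_rows_def)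
  ultimately have "card (crossing_rows j) \<le> card ((UNIV :: bool set) \<times> L)"
    using fin_L by (intro card_inj_on_le) auto
  then show ?thesis by (simp add: card_cartesian_product)
qed

lemma finite_cut_columns: "finite cut_columns"
  by (rule finite_subset[of _ "{..<m}"]) (auto simp: cut_columns_def)

lemma card_cut_columns: "card cut_columns \<le> 3 * card L"
proof -
  have "\<exists>u w. u \<in> A \<and> w \<in> grid - A \<and>
      snd u \<in> {j, Suc j} \<and> snd w \<in> {j, Suc j} \<and> {u, w} \<in> edges (P_graph \<alpha>)"
    if "j \<in> cut_columns" for j
    using that unfolding cut_columns_def by blast
  then obtain u w where uw: "\<And>j. j \<in> cut_columns \<Longrightarrow> u j \<in> A \<and> w j \<in> grid - A \<and>
      snd (u j) \<in> {j, Suc j} \<and> snd (w j) \<in> {j, Suc j} \<and> {u j, w j} \<in> edges (P_graph \<alpha>)"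
    by metis
  let ?f = "\<lambda>j. (j mod 3, lab (u j))"
  have "j = l" if jl: "j \<in> cut_columns" "l \<in> cut_columns" and eq: "?f j = ?f l" for j l
  proof -
    \<comment> \<open>Equal labels make the red end chosen for \<open>l\<close> adjacent to the blue
      end chosen for \<open>j\<close>. Their columns then differ by 1, so \<open>j\<close> and
      \<open>l\<close> differ by at most 2, and equal residues mod 3 make them equal.\<close>
    have "{u l, w j} \<in> edges (P_graph \<alpha>)"
      using twins[of "u j" "u l" "w j"] uw[OF jl(1)] uw[OF jl(2)] eq by auto
    then have "snd (w j) = Suc (snd (u l)) \<or> snd (u l) = Suc (snd (w j))"
      using P_graph_edge_columns[of "fst (u l)" "snd (u l)" "fst (w j)" "snd (w j)"] by simp
    then have "j \<le> l + 2 \<and> l \<le> j + 2"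
      using uw[OF jl(1)] uw[OF jl(2)] by auto
    with eq show ?thesis by (simp, presburger)
  qed
  then have "inj_on ?f cut_columns"
    by (intro inj_onI)
  moreover have "?f ` cut_columns \<subseteq> {..<3} \<times> L"
    using lab_L uw by auto
  ultimately have "card cut_columns \<le> card ({..<3 :: nat} \<times> L)"
    using fin_L by (intro card_inj_on_le) auto
  then show ?thesis by (simp add: card_cartesian_product)
qed

lemma cut_columnsI:
  assumes j: "1 \<le> j" "j < m" and ik: "i \<in> {1..n}" "k \<in> {1..n}"
    and colours: "(i, j) \<in> A \<longleftrightarrow> (k, Suc j) \<notin> A"
    and edge: "\<alpha> j = 0 \<longleftrightarrow> i = k"
  shows "j \<in> cut_columns"
proof (cases "(i, j) \<in> A")
  case True
  then have "(k, Suc j) \<in> grid - A" "{(i, j), (k, Suc j)} \<in> edges (P_graph \<alpha>)"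
    using assms edge_iff[of i k j] by auto
  with True j show ?thesis
    unfolding cut_columns_def by force
next
  case False
  then have "(k, Suc j) \<in> A" "(i, j) \<in> grid - A" "{(k, Suc j), (i, j)} \<in> edges (P_graph \<alpha>)"
    using assms edge_iff'[of i k j] by auto
  with j show ?thesis
    unfolding cut_columns_def by force
qed

text \<open>If a row crosses between two complemented columns without creating an edge between red and
  blue, then every other row crosses as well, with the colours exchanged.\<close>

lemma crossing_imp_cut_column:
  assumes j: "1 \<le> j" "j < m" and i: "i \<in> crossing_rows j" and n: "2 * card L < n - 1"
  shows "j \<in> cut_columns"
proof (rule ccontr)
  assume not_cut: "j \<notin> cut_columns"
  have i': "i \<in> {1..n}" "(i, j) \<in> A \<longleftrightarrow> (i, Suc j) \<notin> A"
    using i by (auto simp: crossing_rows_def)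
  then have "\<alpha> j \<noteq> 0"
    using cut_columnsI[OF j, of i i] not_cut by auto
  \<comment> \<open>Since \<open>\<alpha> j \<noteq> 0\<close>, these pairs from different rows are
    edges, and outside \<open>cut_columns\<close> both ends of an edge have one colour.\<close>
  then have "(i, j) \<in> A \<longleftrightarrow> (k, Suc j) \<in> A" "(k, j) \<in> A \<longleftrightarrow> (i, Suc j) \<in> A"
    if "k \<in> {1..n} - {i}" for k
    using cut_columnsI[OF j, of i k] cut_columnsI[OF j, of k i] i' that not_cut by auto
  then have "{1..n} - {i} \<subseteq> crossing_rows j"
    using i' by (auto simp: crossing_rows_def)
  then have "card ({1..n} - {i}) \<le> card (crossing_rows j)"
    by (intro card_mono) (auto simp: crossing_rows_def)
  \<comment> \<open>The \<open>n - 1\<close> other rows would exceed the bound on crossing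
    rows.\<close>
  with card_crossing_rows[OF j] n i' show False
    by simp
qed

section \<open>Mixed rows and monochromatic rows\<close>

lemma mixed_row_crosses:
  assumes "i \<in> mixed_rows"
  shows "\<exists>j. 1 \<le> j \<and> j < m \<and> i \<in> crossing_rows j"
proof (rule ccontr)
  assume "\<not> ?thesis"
  moreover have "i \<in> {1..n}"
    using assms by (simp add: mixed_rows_def)
  ultimately have same: "(i, Suc j) \<in> A \<longleftrightarrow> (i, j) \<in> A" if "1 \<le> j" "j < m" for j
    using that unfolding crossing_rows_def by blast
  have const: "(i, j) \<in> A \<longleftrightarrow> (i, 1) \<in> A" if "1 \<le> j" "j \<le> m" for j
    using that by (induction j rule: dec_induct) (simp_all add: same)
  from assms obtain j l where "j \<in> {1..m}" "l \<in> {1..m}" "(i, j) \<in> A" "(i, l) \<notin> A"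
    unfolding mixed_rows_def by blast
  with const[of j] const[of l] show False by simp
qed

text \<open>Every mixed row crosses at some cut column; there are at most \<open>3 * card L\<close>
  of these, each with at most \<open>2 * card L\<close> crossing rows.\<close>

lemma card_mixed_rows:
  assumes "2 * card L < n - 1"
  shows "card mixed_rows \<le> 6 * (card L)\<^sup>2"
proof -
  have "mixed_rows \<subseteq> (\<Union>j\<in>cut_columns. crossing_rows j)"
    using mixed_row_crosses crossing_imp_cut_column assms by blast
  then have "card mixed_rows \<le> card (\<Union>j\<in>cut_columns. crossing_rows j)"
    using finite_cut_columns by (intro card_mono) (auto simp: crossing_rows_def)
  also have "\<dots> \<le> (\<Sum>j\<in>cut_columns. card (crossing_rows j))"
    by (rule card_UN_le[OF finite_cut_columns])
  also have "\<dots> \<le> card cut_columns * (2 * card L)"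
    using card_crossing_rows by (intro sum_bounded_above[where 'a = nat, simplified])
      (auto simp: cut_columns_def)
  also have "\<dots> \<le> 3 * card L * (2 * card L)"
    using card_cut_columns by (rule mult_right_mono) simp
  finally show ?thesis by (simp add: power2_eq_square)
qed

lemma pure_rows_imp_cut_column:
  assumes r: "r \<in> {1..n}" "{r} \<times> {1..m} \<subseteq> A"
    and b: "b \<in> {1..n}" "({b} \<times> {1..m}) \<inter> A = {}"
    and j: "1 \<le> j" "j < m" "\<alpha> j = 1"
  shows "j \<in> cut_columns"
proof (rule cut_columnsI[OF j(1,2) r(1) b(1)])
  have "(r, j) \<in> A" "(b, j) \<notin> A" "(b, Suc j) \<notin> A"
    using subsetD[OF r(2), of "(r, j)"] b(2) j unfolding disjoint_iff by auto
  then   show "\<alpha> j = 0 \<longleftrightarrow> r = b" "(r, j) \<in> A \<longleftrightarrow> (b, Suc j) \<notin> A"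
    using j(3) by auto
qed

text \<open>Fewer than \<open>q\<close> rows are mixed, so they hold too few vertices to contain all
  of \<open>A\<close> or all of its complement. Hence an entirely red row and an entirely blue row
  exist, and every 1 gives a cut column.\<close>

lemma card_ones_le:
  assumes n: "n = 3 * q" and q: "6 * (card L)\<^sup>2 < q"
    and lower: "q * m < card A" and upper: "card A \<le> 2 * (q * m)"
  shows "card {j. 1 \<le> j \<and> j < m \<and> \<alpha> j = 1} \<le> 3 * card L"
proof -
  have "card L \<le> (card L)\<^sup>2"
    by (simp add: power2_eq_square)
  then have "2 * card L < n - 1"
    using n q by linarith
  from card_mixed_rows[OF this] have mixed: "card mixed_rows < q"
    using q by simp
  have fin: "finite mixed_rows"
    by (simp add: mixed_rows_def)
  have small: "card X \<le> q * m" if "X \<subseteq> mixed_rows \<times> {1..m}" for X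
  proof -
    have "card X \<le> card mixed_rows * m"
      using card_mono[OF _ that] fin by (simp add: card_cartesian_product)
    with mixed show ?thesis
      by (meson le_trans less_imp_le mult_le_mono1)
  qed
  have "m > 0"
    using lower upper by (cases m) auto
  have "\<exists>r\<in>{1..n}. {r} \<times> {1..m} \<subseteq> A"
  proof (rule ccontr)
    assume "\<not> ?thesis"
    then have "A \<subseteq> mixed_rows \<times> {1..m}"
      using A_subset by (fastforce simp: mixed_rows_def)
    from small[OF this] lower show False by simp
  qed
  moreover have "\<exists>b\<in>{1..n}. ({b} \<times> {1..m}) \<inter> A = {}"
  proof (rule ccontr)
    assume "\<not> ?thesis"
    then have sub: "grid - A \<subseteq> mixed_rows \<times> {1..m}"
      by (fastforce simp: mixed_rows_def)
    \<comment> \<open>Strictness matters here: there may be exactly \<open>q * m\<close> blue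
      vertices, whereas the red ones are strictly more.\<close>
    have "(card mixed_rows) * m < q * m"
      using mixed \<open>m > 0\<close> by simp
    moreover have "card (grid - A) \<le> card mixed_rows * m"
      using card_mono[OF _ sub] fin by (simp add: card_cartesian_product)
    moreover have "card (grid - A) = 3 * (q * m) - card A"
      using card_Diff_subset[OF finite_subset[OF A_subset] A_subset] n
      by (simp add: card_cartesian_product)
    ultimately show False using upper by linarith
  qed
  ultimately have "{j. 1 \<le> j \<and> j < m \<and> \<alpha> j = 1} \<subseteq> cut_columns"
    using pure_rows_imp_cut_column by blast
  from card_mono[OF finite_cut_columns this] card_cut_columns show ?thesis
    by linarith
qed

end

section \<open>Unbounded clique-width of the class\<close>

lemma simple_graph_induced_subgraph:
  "simple_graph G \<Longrightarrow> simple_graph (induced_subgraph G S)"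
  unfolding simple_graph_def induced_subgraph_def by fastforce

lemma induced_subgraph_in_G_class:
  assumes "finite S" "S \<subseteq> verts (P_graph \<alpha>)"
  shows "induced_subgraph (P_graph \<alpha>) S \<in> G_class \<alpha>"
  using assms unfolding G_class_def graph_iso_def
  by (auto intro!: exI[of _ S] exI[of _ id])

theorem lemma2:
  fixes \<alpha> :: "nat \<Rightarrow> nat"
  assumes binary: "\<And>j. 1 \<le> j \<Longrightarrow> \<alpha> j \<in> {0, 1}"
    and ones: "infinite {j. 1 \<le> j \<and> \<alpha> j = 1}"
  shows "\<not> (\<exists>c. \<forall>G \<in> (G_class \<alpha> :: (nat \<times> nat) ugraph set). clique_width G \<le> c)"
proof
  assume "\<exists>c. \<forall>G \<in> (G_class \<alpha> :: (nat \<times> nat) ugraph set). clique_width G \<le> c"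
  then obtain c where c: "\<And>G :: (nat \<times> nat) ugraph. G \<in> G_class \<alpha> \<Longrightarrow> clique_width G \<le> c"
    by blast
  \<comment> \<open>One more 1 than \<open>card_ones_le\<close> allows for \<open>c\<close>
    labels.\<close>
  obtain J where J: "finite J" "card J = Suc (3 * c)" "J \<subseteq> {j. 1 \<le> j \<and> \<alpha> j = 1}"
    using infinite_arbitrarily_large[OF ones] by blast
  \<comment> \<open>The successor keeps column \<open>Suc j\<close> inside the grid for every
    \<open>j\<close> in \<open>J\<close>.\<close>
  define m where "m = Suc (Max J)"
  \<comment> \<open>Just above \<open>6 * c\<^sup>2\<close>, the bound on mixed rows for
    \<open>c\<close> labels.\<close>
  define q where "q = Suc (6 * c\<^sup>2)"
  define S where "S = {1..3 * q} \<times> {1..m}"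
  define G where "G = induced_subgraph (P_graph \<alpha>) S"
  have J_sub: "J \<subseteq> {j. 1 \<le> j \<and> j < m \<and> \<alpha> j = 1}"
    using J by (auto simp: m_def less_Suc_eq_le)
  have "G \<in> G_class \<alpha>"
    unfolding G_def S_def by (rule induced_subgraph_in_G_class) (auto simp: P_graph_def)
  have verts_G: "verts G = S" and card_S: "card S = 3 * (q * m)"
    by (auto simp: G_def induced_subgraph_def S_def card_cartesian_product)
  have pos: "1 \<le> q * m"
    by (simp add: q_def m_def)
  have "finite (verts G)" "verts G \<noteq> {}"
    using card_S pos by (auto simp: verts_G S_def)
  then obtain a where a: "cw_wf a" "cw_graph a = G" "card (cw_labels a) = clique_width G"
    using clique_width_witness[of G] simple_graph_induced_subgraph[OF simple_graph_P_graph]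
    unfolding G_def by blast
  have verts_a: "cw_verts a = S" and edges_a: "cw_edges a = edges G"
    using a(2) verts_G by (auto simp: cw_graph_def)
  have le_c: "card (cw_labels a) \<le> c"
    using a(3) c[OF \<open>G \<in> G_class \<alpha>\<close>] by simp
  obtain A l where tw: "twin_labelling a A l" and card_A: "q * m < card A" "card A \<le> 2 * (q * m)"
    using ex_balanced_twin_labelling[OF a(1) pos] pos card_S verts_a by auto
  then have A: "A \<subseteq> S" "l ` A \<subseteq> cw_labels a"
    by (simp_all add: twin_labelling_def verts_a)
  have edge_G: "{x, z} \<in> edges G \<longleftrightarrow> {x, z} \<in> edges (P_graph \<alpha>)" if "x \<in> S" "z \<in> S" for x z
    using that by (simp add: G_def induced_subgraph_def)
  interpret labelled_cut \<alpha> "3 * q" m A l "cw_labels a"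
  proof unfold_locales
    fix x y z assume xyz: "x \<in> A" "y \<in> A" "l x = l y" "z \<in> {1..3 * q} \<times> {1..m} - A"
    then have "{x, z} \<in> edges G \<longleftrightarrow> {y, z} \<in> edges G"
      using tw unfolding twin_labelling_def edges_a by blast
    with xyz A(1) edge_G show "{x, z} \<in> edges (P_graph \<alpha>) \<longleftrightarrow> {y, z} \<in> edges (P_graph \<alpha>)"
      unfolding S_def by blast
  qed (use A finite_cw_labels binary in \<open>auto simp: S_def\<close>)
  have "6 * (card (cw_labels a))\<^sup>2 < q"
    using le_c by (simp add: q_def less_Suc_eq_le)
  with card_A have "card {j. 1 \<le> j \<and> j < m \<and> \<alpha> j = 1} \<le> 3 * card (cw_labels a)"
    by (intro card_ones_le[of q]) simp_all
  moreover have "card J \<le> card {j. 1 \<le> j \<and> j < m \<and> \<alpha> j = 1}"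
    by (intro card_mono J_sub) (rule finite_subset[of _ "{..<m}"], auto)
  ultimately show False
    using J(2) le_c by simp
qed

end
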